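(* Let $G$ be the path on vertices $1,\dots,n$, let $q=3$, and let $\Omega$ be the set of proper $3$-colorings of $G$. Let $\mathcal{M}_{\rightarrow}$ be the systematic scan on $\Omega$. Then, as $n\to\infty$, $$\mathrm{Mix}\left(\mathcal{M}_{\rightarrow},\tfrac14\right)=O(n^2\log n).$$
   Context: The $n$-vertex path has vertices $1,\dots,n$ and edges $\{i,i+1\}$. A $q$-coloring is a vector $\sigma=(\sigma_1,\dots,\sigma_n)\in\{0,\dots,q-1\}^n$; it is proper if adjacent vertices receive different colors. The procedure Metropolis($v$): choose a color $c\in\{0,\dots,q-1\}$ uniformly at random and propose recoloring $v$ with $c$; the proposal is accepted if and only if $c$ is not used at any neighbor of $v$ (otherwise the coloring is unchanged). One step of the Markov chain $\mathcal{M}_{\rightarrow}$ (systematic scan): for $v=1,2,\dots,n$ in this order, do Metropolis($v$) (with independent color choices). Thus one step is a full sweep of $n$ vertex updates. Its stationary distribution is uniform on $\Omega$. For a Markov chain $\mathcal{M}$ with transition matrix $P$ and stationary distribution $\pi$, $\mathrm{Mix}_x(\mathcal{M},\varepsilon)=\min\{t>0:\mathrm{d_{TV}}(P^t(x,\cdot),\pi(\cdot))\le\varepsilon\}$ and $\mathrm{Mix}(\mathcal{M},\varepsilon)=\max_x\mathrm{Mix}_x(\mathcal{M},\varepsilon)$, where $\mathrm{d_{TV}}(\theta_1,\theta_2)=\frac12\sum_i|\theta_1(i)-\theta_2(i)|$. *)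

theory Defs
  imports "HOL-Probability.Probability" "HOL-Library.Landau_Symbols" "HOL-Library.Extended_Nat"
begin

primrec steps :: "('a \<Rightarrow> 'a pmf) \<Rightarrow> nat \<Rightarrow> 'a \<Rightarrow> 'a pmf" where
  "steps K 0 x = return_pmf x"
| "steps K (Suc t) x = bind_pmf (steps K t x) K"

definition d_TV :: "'a set \<Rightarrow> 'a pmf \<Rightarrow> 'a pmf \<Rightarrow> real" where
  "d_TV S \<mu> \<nu> = 1/2 * (\<Sum>i\<in>S. \<bar>pmf \<mu> i - pmf \<nu> i\<bar>)"

text \<open>
  A chain on the finite state space \<open>S\<close> is given by its kernel \<open>K\<close>, the transition matrix being
  \<open>P x y = pmf (K x) y\<close>. Mixing times are extended naturals, so that a chain that never gets within
  \<open>\<epsilon>\<close> of \<open>\<pi>\<close> has mixing time \<open>\<infinity>\<close>; the infimum of the empty set in the type \<^typ>\<open>nat\<close> would be \<open>0\<close>.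
\<close>

definition Mix_from :: "'a set \<Rightarrow> ('a \<Rightarrow> 'a pmf) \<Rightarrow> 'a pmf \<Rightarrow> real \<Rightarrow> 'a \<Rightarrow> enat" where
  "Mix_from S K \<pi> \<epsilon> x = (INF t \<in> {t. 0 < t \<and> d_TV S (steps K t x) \<pi> \<le> \<epsilon>}. enat t)"

definition Mix :: "'a set \<Rightarrow> ('a \<Rightarrow> 'a pmf) \<Rightarrow> 'a pmf \<Rightarrow> real \<Rightarrow> enat" where
  "Mix S K \<pi> \<epsilon> = (SUP x \<in> S. Mix_from S K \<pi> \<epsilon> x)"

definition path_edges :: "nat \<Rightarrow> nat set set" where
  "path_edges n = {{i, i + 1} | i. 1 \<le> i \<and> i < n}"

text \<open>Colorings are extensional functions, so that distinct functions are distinct colorings.\<close>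

definition proper_colorings :: "nat \<Rightarrow> nat \<Rightarrow> (nat \<Rightarrow> nat) set" where
  "proper_colorings q n =
     {\<sigma> \<in> {1..n} \<rightarrow>\<^sub>E {0..<q}. \<forall>u v. {u, v} \<in> path_edges n \<longrightarrow> \<sigma> u \<noteq> \<sigma> v}"

definition metropolis :: "nat \<Rightarrow> nat \<Rightarrow> nat \<Rightarrow> (nat \<Rightarrow> nat) \<Rightarrow> (nat \<Rightarrow> nat) pmf" where
  "metropolis q n v \<sigma> =
     map_pmf (\<lambda>c. if \<forall>u. {u, v} \<in> path_edges n \<longrightarrow> \<sigma> u \<noteq> c then \<sigma>(v := c) else \<sigma>)
       (pmf_of_set {0..<q})"

definition systematic_scan :: "nat \<Rightarrow> nat \<Rightarrow> (nat \<Rightarrow> nat) \<Rightarrow> (nat \<Rightarrow> nat) pmf" where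
  "systematic_scan q n \<sigma> =
     fold (\<lambda>v \<mu>. bind_pmf \<mu> (metropolis q n v)) [1..<Suc n] (return_pmf \<sigma>)"

definition Mix_scan :: "nat \<Rightarrow> nat \<Rightarrow> real \<Rightarrow> enat" where
  "Mix_scan q n \<epsilon> =
     Mix (proper_colorings q n) (systematic_scan q n) (pmf_of_set (proper_colorings q n)) \<epsilon>"

text \<open>
  The uniform distribution on the proper colorings is well defined and stationary for the scan,
  and the scan does not leave the proper colorings.
\<close>

lemma finite_proper_colorings: "finite (proper_colorings q n)"
  unfolding proper_colorings_def by (auto intro!: finite_PiE)

lemma edge_path: "{u, v} \<in> path_edges n \<longleftrightarrow> (1 \<le> u \<and> u < n \<and> v = u + 1) \<or> (1 \<le> v \<and> v < n \<and> u = v + 1)"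
  unfolding path_edges_def by (auto simp: doubleton_eq_iff)

lemma proper_colorings_nonempty:
  assumes "2 \<le> q" shows "proper_colorings q n \<noteq> {}"
proof -
  have "(\<lambda>i\<in>{1..n}. i mod 2) \<in> proper_colorings q n"
    using assms unfolding proper_colorings_def edge_path
    by (auto simp: mod_Suc PiE_iff less_le_trans[OF mod_less_divisor[of 2]])
  then show ?thesis by blast
qed

lemma metropolis_closed:
  assumes "0 < q" "v \<in> {1..n}" "\<sigma> \<in> proper_colorings q n"
  shows "set_pmf (metropolis q n v \<sigma>) \<subseteq> proper_colorings q n"
proof -
  have "\<sigma>(v := c) \<in> proper_colorings q n"
    if c: "c < q" and "\<forall>u. {u, v} \<in> path_edges n \<longrightarrow> \<sigma> u \<noteq> c" for c
  proof -
    have "\<sigma>(v := c) \<in> {1..n} \<rightarrow>\<^sub>E {0..<q}"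
      using assms c unfolding proper_colorings_def by (auto simp: PiE_iff extensional_def)
    moreover have "(\<sigma>(v := c)) a \<noteq> (\<sigma>(v := c)) b" if e: "{a, b} \<in> path_edges n" for a b
    proof -
      have "a \<noteq> b" using e unfolding edge_path by auto
      moreover have "{b, a} \<in> path_edges n" using e by (simp add: insert_commute)
      ultimately show ?thesis
        using assms(3) e \<open>\<forall>u. {u, v} \<in> path_edges n \<longrightarrow> \<sigma> u \<noteq> c\<close>
        unfolding proper_colorings_def by (cases "a = v"; cases "b = v") auto
    qed
    ultimately show ?thesis unfolding proper_colorings_def by blast
  qed
  with assms show ?thesis by (auto simp: metropolis_def set_pmf_of_set)
qed

lemma vimage_singleton: "A \<inter> f -` {y} = {a}" if "f a = y" "\<And>d. f d = y \<Longrightarrow> d = a" "a \<in> A"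
  using that by blast

lemma metropolis_symmetric:
  assumes "0 < q" "\<sigma> \<in> proper_colorings q n" "\<tau> \<in> proper_colorings q n" "v \<in> {1..n}"
  shows "pmf (metropolis q n v \<sigma>) \<tau> = pmf (metropolis q n v \<tau>) \<sigma>"
proof (cases "\<sigma> = \<tau>")
  case False
  have one: "pmf (metropolis q n v \<sigma>) \<tau> = (if \<exists>c. \<tau> = \<sigma>(v := c) then 1 / q else 0)"
    if s: "\<sigma> \<in> proper_colorings q n" "\<tau> \<in> proper_colorings q n" and ne: "\<sigma> \<noteq> \<tau>" for \<sigma> \<tau>
  proof -
    have free: "\<tau> u \<noteq> \<tau> v" "u \<noteq> v" if "{u, v} \<in> path_edges n" for u
      using s that unfolding proper_colorings_def edge_path by auto
    have lt: "\<tau> v < q" using s assms(4) unfolding proper_colorings_def by auto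
    have upd: "\<sigma>(v := c) = \<tau> \<Longrightarrow> c = \<tau> v" for c by auto
    have undo: "\<tau> = \<sigma>(v := c) \<Longrightarrow> \<sigma>(v := \<tau> v) = \<tau>" for c by simp
    have keep: "{u, v} \<in> path_edges n \<Longrightarrow> \<tau> = \<sigma>(v := c) \<Longrightarrow> \<sigma> u \<noteq> \<tau> v" for u c
      using free[of u] by auto
    have eq: "{0..<q} \<inter>
        (\<lambda>c. if \<forall>u. {u, v} \<in> path_edges n \<longrightarrow> \<sigma> u \<noteq> c then \<sigma>(v := c) else \<sigma>) -` {\<tau>}
        = (if \<exists>c. \<tau> = \<sigma>(v := c) then {\<tau> v} else {})"
      (is "{0..<q} \<inter> ?f -` _ = _")
    proof (cases "\<exists>c. \<tau> = \<sigma>(v := c)")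
      case True
      then obtain c where c: "\<tau> = \<sigma>(v := c)" by blast
      have "?f (\<tau> v) = \<tau>" using keep[OF _ c] undo[OF c] by simp
      moreover have "d = \<tau> v" if "?f d = \<tau>" for d
        using that ne upd by (metis (full_types))
      moreover have "\<tau> v \<in> {0..<q}" using lt by simp
      ultimately have "{0..<q} \<inter> ?f -` {\<tau>} = {\<tau> v}"
        by (rule vimage_singleton)
      with True show ?thesis by simp
    next
      case False
      then have "?f d \<noteq> \<tau>" for d using ne by metis
      with False show ?thesis by auto
    qed
    have "pmf (metropolis q n v \<sigma>) \<tau> =
       card (if \<exists>c. \<tau> = \<sigma>(v := c) then {\<tau> v} else {}) / q"
      unfolding metropolis_def pmf_map using assms(1)
      by (subst measure_pmf_of_set) (simp_all only: eq, auto)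
    then show ?thesis by auto
  qed
  have "(\<exists>c. \<tau> = \<sigma>(v := c)) \<longleftrightarrow> (\<exists>c. \<sigma> = \<tau>(v := c))"
    by (metis fun_upd_triv fun_upd_upd)
  with False assms show ?thesis by (simp add: one)
qed simp

lemma metropolis_stationary:
  assumes "2 \<le> q" "v \<in> {1..n}"
  shows "bind_pmf (pmf_of_set (proper_colorings q n)) (metropolis q n v)
    = pmf_of_set (proper_colorings q n)" (is "bind_pmf ?U _ = _")
proof (rule pmf_eqI)
  fix \<tau>
  let ?S = "proper_colorings q n"
  note S = finite_proper_colorings[of q n] proper_colorings_nonempty[OF assms(1), of n]
  have b: "pmf (bind_pmf ?U (metropolis q n v)) \<tau>
      = (\<Sum>\<sigma>\<in>?S. pmf (metropolis q n v \<sigma>) \<tau>) / card ?S"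
    using S by (simp add: pmf_bind_pmf_of_set)
  show "pmf (bind_pmf ?U (metropolis q n v)) \<tau> = pmf ?U \<tau>"
  proof (cases "\<tau> \<in> ?S")
    case True
    then have "(\<Sum>\<sigma>\<in>?S. pmf (metropolis q n v \<sigma>) \<tau>) = (\<Sum>\<sigma>\<in>?S. pmf (metropolis q n v \<tau>) \<sigma>)"
      using assms by (intro sum.cong refl metropolis_symmetric) auto
    also have "\<dots> = 1"
      using assms True S by (intro sum_pmf_eq_1 metropolis_closed) auto
    finally show ?thesis using S True by (simp add: b)
  next
    case False
    then have "pmf (metropolis q n v \<sigma>) \<tau> = 0" if "\<sigma> \<in> ?S" for \<sigma>
      using metropolis_closed[of q v n \<sigma>] that assms by (auto simp: set_pmf_iff)
    then show ?thesis using S False by (simp add: b)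
  qed
qed

lemma systematic_scan_closed:
  assumes "0 < q" "\<sigma> \<in> proper_colorings q n"
  shows "set_pmf (systematic_scan q n \<sigma>) \<subseteq> proper_colorings q n"
proof -
  have "set_pmf (fold (\<lambda>v \<mu>. bind_pmf \<mu> (metropolis q n v)) vs \<mu>) \<subseteq> proper_colorings q n"
    if "set vs \<subseteq> {1..n}" "set_pmf \<mu> \<subseteq> proper_colorings q n" for vs \<mu>
    using that
  proof (induction vs arbitrary: \<mu>)
    case (Cons v vs)
    have "set_pmf (metropolis q n v \<tau>) \<subseteq> proper_colorings q n" if "\<tau> \<in> set_pmf \<mu>" for \<tau>
      using Cons.prems that by (intro metropolis_closed[OF assms(1)]) auto
    then have "set_pmf (bind_pmf \<mu> (metropolis q n v)) \<subseteq> proper_colorings q n"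
      unfolding set_bind_pmf by blast
    moreover have "set vs \<subseteq> {1..n}" using Cons.prems(1) by simp
    ultimately show ?case unfolding fold_Cons comp_apply by (intro Cons.IH)
  qed simp
  from this[of "[1..<Suc n]" "return_pmf \<sigma>"] show ?thesis
    using assms unfolding systematic_scan_def
    by (simp add: atLeastLessThanSuc_atLeastAtMost del: upt_Suc)
qed

lemma systematic_scan_stationary:
  assumes "2 \<le> q"
  shows "bind_pmf (pmf_of_set (proper_colorings q n)) (systematic_scan q n)
    = pmf_of_set (proper_colorings q n)" (is "bind_pmf ?U _ = _")
proof -
  have lin: "bind_pmf \<nu> (\<lambda>\<sigma>. fold (\<lambda>v \<mu>. bind_pmf \<mu> (metropolis q n v)) vs (f \<sigma>))
      = fold (\<lambda>v \<mu>. bind_pmf \<mu> (metropolis q n v)) vs (bind_pmf \<nu> f)"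
    for vs and \<nu> :: "(nat \<Rightarrow> nat) pmf" and f
    by (induction vs arbitrary: f) (simp_all add: bind_assoc_pmf)
  have "fold (\<lambda>v \<mu>. bind_pmf \<mu> (metropolis q n v)) vs ?U = ?U" if "set vs \<subseteq> {1..n}" for vs
    using that by (induction vs) (auto simp: metropolis_stationary[OF assms])
  from this[of "[1..<Suc n]"] show ?thesis
    unfolding systematic_scan_def lin bind_return_pmf'
    by (simp add: atLeastLessThanSuc_atLeastAtMost del: upt_Suc)
qed

end

theory Submission
  imports Defs
begin

text \<open>
  A proper 3-coloring of the path lifts to a height function: an integer sequence whose consecutive
  entries differ by one and whose residues modulo 3 are the colors. In terms of heights, a
  Metropolis update at \<open>v\<close> reflects the height at \<open>v\<close> across its neighbors with probability \<open>1/3\<close>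
  (\<open>coloring_of_flip\<close>), so that in expectation the update is linear: the height moves by one third
  of a discrete Laplacian with reflecting ends.

  Take two height functions \<open>h\<close> and \<open>h'\<close> whose gap \<open>D = h' - h\<close> takes only the values 0, 2, 4, 6. The
  colorings agree when \<open>D\<close> is constantly 0 and also when it is constantly 6. The coupling
  \<open>coupled\<close> keeps the gap within this range for ever. A weighted sum \<open>S\<close> of the gaps is a martingale,
  because the update of the mean is linear; under the scan the right weights, found from the
  requirement that they recur after a sweep, give each edge weight 3 at its more recently updated
  endpoint and weight 1 at the other one (\<open>weighted_gap_update\<close>). With \<open>M = 24 (n - 1)\<close> the
  value of \<open>S\<close> for the constant gap 6, the potential \<open>S (M - S)\<close> therefore drops on average by
  exactly the variance of the increment of \<open>S\<close>. Unless the gap is constantly 0 or 6, some vertex of the sweep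
  contributes a variance of at least 8 (\<open>potential_drop_scan\<close>): if the gap is not constant, it is
  not discretely harmonic, and where its Laplacian does not vanish the two copies do not move in
  the same way; if it is constantly 2 or 4, the two copies move at different times, and vertex 1
  can always move. As the potential is at most \<open>144 n\<^sup>2\<close>, a drop by 8 is a contraction
  by the factor \<open>1 - 1 / (18 n\<^sup>2)\<close>.

  The potential is an integer which vanishes only if the colorings agree, so its
  expectation bounds the total variation distance of such a pair (\<open>d_TV_near\<close>). Arbitrary
  colorings are joined by \<open>2 n\<close> such pairs: if \<open>h \<le> g\<close> are lifts of the same parity, the sequence
  \<open>min (h + 6 j) g\<close> runs from \<open>h\<close> to \<open>g\<close> and increases by at most 6 in each step (\<open>near_chain\<close>).
  Altogether the distance to stationarity after \<open>t\<close> sweeps is at most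
  \<open>288 n\<^sup>3 (1 - 1 / (18 n\<^sup>2))\<^sup>t\<close>, which is small once \<open>t\<close> is a large multiple of \<open>n\<^sup>2 ln n\<close>.
\<close>

section \<open>Kernels built from a sequence of updates\<close>

text \<open>
  The fold that defines the scan runs forward on distributions. Written as a kernel that starts with
  the first update, the same process allows backward induction on the updates still to be done.
\<close>

primrec sweep :: "('v \<Rightarrow> 'a \<Rightarrow> 'a pmf) \<Rightarrow> 'v list \<Rightarrow> 'a \<Rightarrow> 'a pmf" where
  "sweep K [] = return_pmf"
| "sweep K (v # vs) = (\<lambda>x. bind_pmf (K v x) (sweep K vs))"

lemma fold_bind_eq_sweep: "fold (\<lambda>v \<mu>. bind_pmf \<mu> (K v)) vs \<mu> = bind_pmf \<mu> (sweep K vs)"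
  by (induction vs arbitrary: \<mu>) (simp_all add: bind_return_pmf' bind_assoc_pmf)

lemma systematic_scan_eq_sweep: "systematic_scan q n = sweep (metropolis q n) [1..<Suc n]"
  unfolding systematic_scan_def fold_bind_eq_sweep by (simp add: bind_return_pmf fun_eq_iff)

lemma steps_closed:
  assumes "\<And>x. x \<in> A \<Longrightarrow> set_pmf (K x) \<subseteq> A" "x \<in> A"
  shows "set_pmf (steps K t x) \<subseteq> A"
  using assms by (induction t) fastforce+

lemma sweep_closed:
  assumes "\<And>v x. v \<in> set vs \<Longrightarrow> x \<in> A \<Longrightarrow> set_pmf (K v x) \<subseteq> A" "x \<in> A"
  shows "set_pmf (sweep K vs x) \<subseteq> A"
  using assms by (induction vs arbitrary: x) fastforce+

lemma finite_set_steps: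
  assumes "\<And>x. finite (set_pmf (K x))"
  shows "finite (set_pmf (steps K t x))"
  using assms by (induction t) auto

lemma finite_set_sweep:
  assumes "\<And>v x. finite (set_pmf (K v x))"
  shows "finite (set_pmf (sweep K vs x))"
  using assms by (induction vs arbitrary: x) auto

text \<open>
  Projecting each single update projects the whole process; this is how the marginals of a coupling
  are computed. The hypotheses are restricted to an invariant set \<open>A\<close>, since the coupling below has
  the right marginals only on pairs of height functions.
\<close>

lemma map_sweep_semiconj:
  assumes "\<And>v x. v \<in> set vs \<Longrightarrow> x \<in> A \<Longrightarrow> set_pmf (K v x) \<subseteq> A"
    and "\<And>v x. v \<in> set vs \<Longrightarrow> x \<in> A \<Longrightarrow> map_pmf f (K v x) = K' v (f x)" and "x \<in> A"
  shows "map_pmf f (sweep K vs x) = sweep K' vs (f x)"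
  using assms
proof (induction vs arbitrary: x)
  case (Cons v vs)
  have "bind_pmf (K v x) (\<lambda>y. map_pmf f (sweep K vs y)) = bind_pmf (K v x) (\<lambda>y. sweep K' vs (f y))"
    using Cons.prems by (intro bind_pmf_cong refl Cons.IH) auto
  also have "\<dots> = bind_pmf (map_pmf f (K v x)) (sweep K' vs)"
    by (simp add: bind_map_pmf)
  finally show ?case using Cons.prems by (simp add: map_bind_pmf)
qed simp

lemma map_steps_semiconj:
  assumes "\<And>x. x \<in> A \<Longrightarrow> set_pmf (K x) \<subseteq> A"
    and "\<And>x. x \<in> A \<Longrightarrow> map_pmf f (K x) = K' (f x)" and "x \<in> A"
  shows "map_pmf f (steps K t x) = steps K' t (f x)"
proof (induction t)
  case (Suc t)
  have "bind_pmf (steps K t x) (\<lambda>y. map_pmf f (K y)) = bind_pmf (steps K t x) (\<lambda>y. K' (f y))"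
    using steps_closed[of A K x t] assms by (intro bind_pmf_cong refl) auto
  also have "\<dots> = bind_pmf (map_pmf f (steps K t x)) K'"
    by (simp add: bind_map_pmf)
  finally show ?case using Suc by (simp add: map_bind_pmf)
qed simp

lemma expectation_bind_finite:
  fixes f :: "'b \<Rightarrow> real"
  assumes "finite (set_pmf \<mu>)" "\<And>x. finite (set_pmf (K x))"
  shows "measure_pmf.expectation (bind_pmf \<mu> K) f
    = measure_pmf.expectation \<mu> (\<lambda>x. measure_pmf.expectation (K x) f)"
  using assms
  by (subst pmf_expectation_bind[of "set_pmf \<mu>"], simp_all add: integral_measure_pmf[of "set_pmf \<mu>"])

lemma expectation_mono_finite:
  fixes f :: "'b \<Rightarrow> real"
  assumes "finite (set_pmf \<mu>)" "\<And>x. x \<in> set_pmf \<mu> \<Longrightarrow> f x \<le> g x"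
  shows "measure_pmf.expectation \<mu> f \<le> measure_pmf.expectation \<mu> g"
  using assms by (intro integral_mono_AE integrable_measure_pmf_finite) (auto simp: AE_measure_pmf_iff)

lemma expectation_steps_contract:
  fixes \<Phi> :: "'a \<Rightarrow> real"
  assumes fin: "\<And>x. finite (set_pmf (K x))" and closed: "\<And>x. x \<in> A \<Longrightarrow> set_pmf (K x) \<subseteq> A"
    and contract: "\<And>x. x \<in> A \<Longrightarrow> measure_pmf.expectation (K x) \<Phi> \<le> \<rho> * \<Phi> x"
    and "0 \<le> \<rho>" "x \<in> A"
  shows "measure_pmf.expectation (steps K t x) \<Phi> \<le> \<rho> ^ t * \<Phi> x"
proof (induction t)
  case (Suc t)
  have "measure_pmf.expectation (steps K (Suc t) x) \<Phi>
      \<le> measure_pmf.expectation (steps K t x) (\<lambda>y. \<rho> * \<Phi> y)"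
    unfolding steps.simps expectation_bind_finite[OF finite_set_steps[OF fin] fin]
    using steps_closed[of A K x t, OF closed \<open>x \<in> A\<close>] contract
    by (intro expectation_mono_finite finite_set_steps fin) auto
  also have "\<dots> \<le> \<rho> * (\<rho> ^ t * \<Phi> x)"
    using Suc \<open>0 \<le> \<rho>\<close> by (simp add: mult_left_mono)
  finally show ?case by (simp add: mult.assoc)
qed simp

section \<open>Total variation distance and mixing time\<close>

text \<open>
  The coupling inequality combined with Markov's inequality: \<open>\<Phi>\<close> dominates the indicator of
  disagreement.
\<close>

lemma d_TV_le_expectation_coupling:
  fixes f g :: "'a \<Rightarrow> 'b" and \<Phi> :: "'a \<Rightarrow> real"
  assumes "finite S" "finite (set_pmf \<mu>)"
    and "\<And>x. x \<in> set_pmf \<mu> \<Longrightarrow> 0 \<le> \<Phi> x"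
    and "\<And>x. x \<in> set_pmf \<mu> \<Longrightarrow> f x \<noteq> g x \<Longrightarrow> 1 \<le> \<Phi> x"
  shows "d_TV S (map_pmf f \<mu>) (map_pmf g \<mu>) \<le> measure_pmf.expectation \<mu> \<Phi>"
proof -
  have pm: "pmf (map_pmf h \<mu>) i = (\<Sum>x\<in>set_pmf \<mu>. pmf \<mu> x * of_bool (h x = i))" for h :: "'a \<Rightarrow> 'b" and i
  proof -
    have "pmf (map_pmf h \<mu>) i = measure_pmf.expectation \<mu> (indicator (h -` {i}))"
      by (simp add: pmf_map)
    also have "(indicator (h -` {i}) :: _ \<Rightarrow> real) = (\<lambda>x. of_bool (h x = i))"
      by (auto simp: indicator_def)
    also have "measure_pmf.expectation \<mu> (\<lambda>x. of_bool (h x = i))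
        = (\<Sum>x\<in>set_pmf \<mu>. pmf \<mu> x * of_bool (h x = i))"
      using assms by (subst integral_measure_pmf[of "set_pmf \<mu>"]) auto
    finally show ?thesis .
  qed
  have "\<bar>pmf (map_pmf f \<mu>) i - pmf (map_pmf g \<mu>) i\<bar>
      \<le> (\<Sum>x\<in>set_pmf \<mu>. pmf \<mu> x * \<bar>of_bool (f x = i) - of_bool (g x = i)\<bar>)" for i
    unfolding pm sum_subtractf[symmetric] right_diff_distrib[symmetric]
    by (rule order_trans[OF sum_abs]) (simp add: abs_mult)
  then have "d_TV S (map_pmf f \<mu>) (map_pmf g \<mu>)
      \<le> 1/2 * (\<Sum>i\<in>S. \<Sum>x\<in>set_pmf \<mu>. pmf \<mu> x * \<bar>of_bool (f x = i) - of_bool (g x = i)\<bar>)"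
    unfolding d_TV_def by (intro mult_left_mono sum_mono) auto
  also have "\<dots> = (\<Sum>x\<in>set_pmf \<mu>. pmf \<mu> x * (1/2 * (\<Sum>i\<in>S. \<bar>of_bool (f x = i) - of_bool (g x = i)\<bar>)))"
    by (subst sum.swap) (simp add: sum_distrib_left mult_ac)
  also have "\<dots> \<le> (\<Sum>x\<in>set_pmf \<mu>. pmf \<mu> x * \<Phi> x)"
  proof (intro sum_mono mult_left_mono)
    fix x assume x: "x \<in> set_pmf \<mu>"
    show "1/2 * (\<Sum>i\<in>S. \<bar>of_bool (f x = i) - of_bool (g x = i)\<bar>) \<le> \<Phi> x"
    proof (cases "f x = g x")
      case False
      have "(\<Sum>i\<in>S. \<bar>of_bool (f x = i) - of_bool (g x = i)\<bar> :: real)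
          \<le> (\<Sum>i\<in>S. (if f x = i then 1 else 0) + (if g x = i then 1 else 0))"
        by (intro sum_mono) auto
      also have "\<dots> \<le> 2" using \<open>finite S\<close> by (simp add: sum.distrib)
      finally show ?thesis using assms(4)[OF x False] by simp
    qed (use assms(3) x in auto)
  qed auto
  also have "\<dots> = measure_pmf.expectation \<mu> \<Phi>"
    using assms by (subst integral_measure_pmf[of "set_pmf \<mu>"]) auto
  finally show ?thesis .
qed

lemma d_TV_triangle: "d_TV S \<mu> \<xi> \<le> d_TV S \<mu> \<nu> + d_TV S \<nu> \<xi>"
proof -
  have "(\<Sum>i\<in>S. \<bar>pmf \<mu> i - pmf \<xi> i\<bar>) \<le> (\<Sum>i\<in>S. \<bar>pmf \<mu> i - pmf \<nu> i\<bar> + \<bar>pmf \<nu> i - pmf \<xi> i\<bar>)"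
    by (intro sum_mono) linarith
  then show ?thesis unfolding d_TV_def by (simp add: sum.distrib)
qed

lemma d_TV_chain: "d_TV S (\<mu> 0) (\<mu> (m::nat)) \<le> (\<Sum>j<m. d_TV S (\<mu> j) (\<mu> (Suc j)))"
proof (induction m)
  case (Suc m)
  then show ?case using d_TV_triangle[of S "\<mu> 0" "\<mu> (Suc m)" "\<mu> m"] by simp
qed (simp add: d_TV_def)

lemma steps_stationary:
  assumes "bind_pmf \<pi> K = \<pi>"
  shows "bind_pmf \<pi> (steps K t) = \<pi>"
proof (induction t)
  case (Suc t)
  have "steps K (Suc t) = (\<lambda>x. bind_pmf (steps K t x) K)" by (simp add: fun_eq_iff)
  then have "bind_pmf \<pi> (steps K (Suc t)) = bind_pmf (bind_pmf \<pi> (steps K t)) K"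
    by (simp only: bind_assoc_pmf)
  then show ?case by (simp only: Suc assms)
qed (simp add: bind_return_pmf')

text \<open>
  The stationary distribution is the average of the laws started at all states, and the distance is
  convex.
\<close>

lemma d_TV_stationary_le:
  assumes fin: "finite S" and ne: "S \<noteq> {}"
    and stat: "bind_pmf (pmf_of_set S) K = pmf_of_set S"
    and close: "\<And>y. y \<in> S \<Longrightarrow> d_TV S (steps K t x) (steps K t y) \<le> \<epsilon>"
  shows "d_TV S (steps K t x) (pmf_of_set S) \<le> \<epsilon>"
proof -
  let ?P = "\<lambda>y. pmf (steps K t y)" and ?N = "real (card S)"
  have N: "?N > 0" using fin ne by (simp add: card_gt_0_iff)
  have avg: "pmf (pmf_of_set S) i = (\<Sum>y\<in>S. ?P y i) / ?N" for i
    using fin ne by (subst steps_stationary[OF stat, of t, symmetric]) (simp add: pmf_bind_pmf_of_set)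
  have "\<bar>?P x i - pmf (pmf_of_set S) i\<bar> \<le> (\<Sum>y\<in>S. \<bar>?P x i - ?P y i\<bar>) / ?N" for i
  proof -
    have "?P x i - pmf (pmf_of_set S) i = (\<Sum>y\<in>S. ?P x i - ?P y i) / ?N"
      unfolding avg using N by (simp add: sum_subtractf field_simps)
    then show ?thesis using N by (simp add: divide_right_mono sum_abs)
  qed
  then have "d_TV S (steps K t x) (pmf_of_set S) \<le> 1/2 * (\<Sum>i\<in>S. (\<Sum>y\<in>S. \<bar>?P x i - ?P y i\<bar>) / ?N)"
    unfolding d_TV_def by (intro mult_left_mono sum_mono) auto
  also have "\<dots> = (\<Sum>y\<in>S. d_TV S (steps K t x) (steps K t y)) / ?N"
    unfolding d_TV_def by (simp add: sum_divide_distrib[symmetric] sum_distrib_left[symmetric]) (rule disjI2, rule sum.swap)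
  also have "\<dots> \<le> (\<Sum>y\<in>S. \<epsilon>) / ?N"
    using N close by (intro divide_right_mono sum_mono) auto
  also have "\<dots> = \<epsilon>" using N by simp
  finally show ?thesis .
qed

lemma Mix_le:
  assumes "0 < t" "\<And>x. x \<in> S \<Longrightarrow> d_TV S (steps K t x) \<pi> \<le> \<epsilon>"
  shows "Mix S K \<pi> \<epsilon> \<le> enat t"
  unfolding Mix_def Mix_from_def using assms by (intro SUP_least INF_lower) auto

section \<open>Height functions\<close>

definition height_fun :: "nat \<Rightarrow> (nat \<Rightarrow> int) \<Rightarrow> bool" where
  "height_fun n h \<longleftrightarrow> (\<forall>i. 1 \<le> i \<and> i < n \<longrightarrow> \<bar>h (Suc i) - h i\<bar> = 1)"

text \<open>
  The sum over the neighbors, with the only neighbor of an end counted twice, as if the path were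
  reflected there.
\<close>

definition nbs :: "nat \<Rightarrow> nat \<Rightarrow> (nat \<Rightarrow> int) \<Rightarrow> int" where
  "nbs n v h = (if v = 1 then 2 * h 2 else if v = n then 2 * h (n - 1) else h (v - 1) + h (Suc v))"

abbreviation laplacian :: "nat \<Rightarrow> nat \<Rightarrow> (nat \<Rightarrow> int) \<Rightarrow> int" where
  "laplacian n v h \<equiv> nbs n v h - 2 * h v"

text \<open>
  Where \<open>h\<close> passes monotonically through \<open>v\<close>, this leaves \<open>h\<close> unchanged; at a local
  extremum it replaces a minimum by a maximum and conversely.
\<close>

definition flip :: "nat \<Rightarrow> nat \<Rightarrow> (nat \<Rightarrow> int) \<Rightarrow> nat \<Rightarrow> int" where
  "flip n v h = h(v := nbs n v h - h v)"

definition coloring_of :: "nat \<Rightarrow> (nat \<Rightarrow> int) \<Rightarrow> nat \<Rightarrow> nat" where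
  "coloring_of n h = (\<lambda>i\<in>{1..n}. nat (h i mod 3))"

lemma height_step: "height_fun n h \<Longrightarrow> 1 \<le> i \<Longrightarrow> i < n \<Longrightarrow> h (Suc i) = h i + 1 \<or> h (Suc i) = h i - 1"
  unfolding height_fun_def by (drule spec[of _ i]) arith

lemma height_step_left:
  "height_fun n h \<Longrightarrow> 1 < i \<Longrightarrow> i \<le> n \<Longrightarrow> h (i - 1) = h i + 1 \<or> h (i - 1) = h i - 1"
  using height_step[of n h "i - 1"] by auto

lemma height_fun_flip:
  assumes h: "height_fun n h" and "3 \<le> n" "1 \<le> v" "v \<le> n"
  shows "height_fun n (flip n v h)"
  unfolding height_fun_def
proof (intro allI impI)
  fix i assume i: "1 \<le> i \<and> i < n"
  have s: "h (Suc i) = h i + 1 \<or> h (Suc i) = h i - 1" using height_step[OF h] i by blast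
  show "\<bar>flip n v h (Suc i) - flip n v h i\<bar> = 1"
  proof (cases "v = i")
    case True
    then show ?thesis
      using s i height_step_left[OF h, of i] \<open>3 \<le> n\<close>
      by (cases "i = 1") (auto simp: flip_def nbs_def numeral_2_eq_2)
  next
    case False
    show ?thesis
    proof (cases "v = Suc i")
      case True
      then show ?thesis
        using s i height_step[OF h, of "Suc i"] \<open>3 \<le> n\<close>
        by (cases "Suc i = n") (auto simp: flip_def nbs_def)
    next
      case False
      with \<open>v \<noteq> i\<close> show ?thesis using s by (auto simp: flip_def)
    qed
  qed
qed

lemma laplacian_height:
  assumes h: "height_fun n h" and "3 \<le> n" "1 \<le> v" "v \<le> n"
  shows "laplacian n v h \<in> {-2, 0, 2}"
  using height_step[OF h, of v] height_step_left[OF h, of v] assms(2-4)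
  by (cases "v = 1"; cases "v = n") (auto simp: nbs_def numeral_2_eq_2)

text \<open>
  An end of the path is always a local extremum, hence always free to move.
\<close>

lemma laplacian_end_nonzero:
  assumes h: "height_fun n h" and "3 \<le> n"
  shows "laplacian n 1 h \<noteq> 0"
  using height_step[OF h, of 1] assms(2) by (auto simp: nbs_def numeral_2_eq_2)

abbreviation U3 :: "nat pmf" where "U3 \<equiv> pmf_of_set {0..<3}"

text \<open>
  Only the probability of the value that triggers a move matters. The coupling can thus choose this
  value depending on the state of both copies.
\<close>

lemma map_if_eq_U3:
  assumes "a < 3" "c < 3"
  shows "map_pmf (\<lambda>u. if u = a then x else y) U3 = map_pmf (\<lambda>u. if u = c then x else y) U3"
proof -
  have "bij_betw (Transposition.transpose a c) {0..<3} {0..<3}"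
    using assms by (intro permutes_imp_bij permutes_swap_id) auto
  then have "U3 = map_pmf (Transposition.transpose a c) U3"
    by (subst map_pmf_of_set_bij_betw) auto
  then have "map_pmf (\<lambda>u. if u = c then x else y) U3
      = map_pmf (\<lambda>u. if u = c then x else y) (map_pmf (Transposition.transpose a c) U3)" by simp
  also have "\<dots> = map_pmf (\<lambda>u. if u = a then x else y) U3"
    unfolding pmf.map_comp by (intro map_pmf_cong refl) (auto simp: Transposition.transpose_def)
  finally show ?thesis by simp
qed

lemma mod_3_neighbours:
  fixes x :: int
  shows "x mod 3 = 0 \<and> (x + 1) mod 3 = 1 \<and> (x - 1) mod 3 = 2 \<and> (x + 2) mod 3 = 2 \<and> (x - 2) mod 3 = 1 \<or>
    x mod 3 = 1 \<and> (x + 1) mod 3 = 2 \<and> (x - 1) mod 3 = 0 \<and> (x + 2) mod 3 = 0 \<and> (x - 2) mod 3 = 2 \<or>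
    x mod 3 = 2 \<and> (x + 1) mod 3 = 0 \<and> (x - 1) mod 3 = 1 \<and> (x + 2) mod 3 = 1 \<and> (x - 2) mod 3 = 0"
proof -
  have m: "(x + 1) mod 3 = (x mod 3 + 1) mod 3" "(x - 1) mod 3 = (x mod 3 - 1) mod 3"
    "(x + 2) mod 3 = (x mod 3 + 2) mod 3" "(x - 2) mod 3 = (x mod 3 - 2) mod 3"
    by (simp_all add: mod_simps)
  have "x mod 3 \<in> {0..<3}" by simp
  also have "{0..<3::int} = {0, 1, 2}" by auto
  finally show ?thesis unfolding m by (elim insertE emptyE; simp only:; simp)
qed

text \<open>
  Of three colors, those avoided by the neighbors of \<open>x\<close> are that of \<open>x\<close> itself and that of its
  reflection.
\<close>

lemma free_color_mod_3:
  fixes x y z c :: int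
  assumes "y = x + 1 \<or> y = x - 1" "z = x + 1 \<or> z = x - 1" "c = 0 \<or> c = 1 \<or> c = 2"
  shows "y mod 3 \<noteq> c \<and> z mod 3 \<noteq> c \<longleftrightarrow> x mod 3 = c \<or> (y + z - x) mod 3 = c"
proof -
  have key: "a \<noteq> c \<and> b \<noteq> c \<longleftrightarrow> x mod 3 = c \<or> d = c"
    if "a = (x + 1) mod 3 \<and> b = (x + 1) mod 3 \<and> d = (x + 2) mod 3
      \<or> a = (x - 1) mod 3 \<and> b = (x - 1) mod 3 \<and> d = (x - 2) mod 3
      \<or> a = (x + 1) mod 3 \<and> b = (x - 1) mod 3 \<and> d = x mod 3
      \<or> a = (x - 1) mod 3 \<and> b = (x + 1) mod 3 \<and> d = x mod 3" for a b d :: int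
    using that mod_3_neighbours[of x] assms(3) by (smt (verit))
  have "y + z - x = x + 2 \<and> y = x + 1 \<and> z = x + 1 \<or> y + z - x = x - 2 \<and> y = x - 1 \<and> z = x - 1
      \<or> y + z - x = x \<and> y = x + 1 \<and> z = x - 1 \<or> y + z - x = x \<and> y = x - 1 \<and> z = x + 1"
    using assms(1,2) by linarith
  then have "y mod 3 = (x + 1) mod 3 \<and> z mod 3 = (x + 1) mod 3 \<and> (y + z - x) mod 3 = (x + 2) mod 3
      \<or> y mod 3 = (x - 1) mod 3 \<and> z mod 3 = (x - 1) mod 3 \<and> (y + z - x) mod 3 = (x - 2) mod 3
      \<or> y mod 3 = (x + 1) mod 3 \<and> z mod 3 = (x - 1) mod 3 \<and> (y + z - x) mod 3 = x mod 3
      \<or> y mod 3 = (x - 1) mod 3 \<and> z mod 3 = (x + 1) mod 3 \<and> (y + z - x) mod 3 = x mod 3"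
    by metis
  then show ?thesis by (rule key)
qed

text \<open>
  Besides the current color of \<open>v\<close>, which changes nothing, the only proposal that Metropolis accepts
  is the color of the reflected height.
\<close>

lemma coloring_of_flip:
  assumes h: "height_fun n h" and "3 \<le> n" "1 \<le> v" "v \<le> n" "a < 3"
  shows "map_pmf (\<lambda>u. coloring_of n (if u = a then flip n v h else h)) U3
    = metropolis 3 n v (coloring_of n h)"
proof -
  let ?\<sigma> = "coloring_of n h" and ?c = "nat ((nbs n v h - h v) mod 3)"
  have fl: "coloring_of n (flip n v h) = ?\<sigma>(v := ?c)"
    using assms by (auto simp: coloring_of_def flip_def)
  have val: "?\<sigma> u = nat (h u mod 3)" if "1 \<le> u" "u \<le> n" for u
    using that by (simp add: coloring_of_def)
  have acc: "(if \<forall>u. {u, v} \<in> path_edges n \<longrightarrow> ?\<sigma> u \<noteq> c then ?\<sigma>(v := c) else ?\<sigma>)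
      = (if c = ?c then ?\<sigma>(v := ?c) else ?\<sigma>)" if "c < 3" for c
  proof -
    have c: "int c = 0 \<or> int c = 1 \<or> int c = 2" using that by auto
    have nat_mod: "nat (x mod 3) = c \<longleftrightarrow> x mod 3 = int c" for x :: int
      by (auto simp: nat_eq_iff)
    consider "v = 1" | "v = n" "v \<noteq> 1" | "1 < v" "v < n" using assms by linarith
    then have "(\<forall>u. {u, v} \<in> path_edges n \<longrightarrow> ?\<sigma> u \<noteq> c) \<longleftrightarrow> ?\<sigma> v = c \<or> ?c = c"
    proof cases
      case 1
      then have e: "{u, v} \<in> path_edges n \<longleftrightarrow> u = 2" for u
        using \<open>3 \<le> n\<close> by (auto simp: edge_path)
      have s: "h 2 = h 1 + 1 \<or> h 2 = h 1 - 1"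
        using height_step[OF h, of 1] \<open>3 \<le> n\<close> by (simp add: numeral_2_eq_2)
      have "nbs n v h = h 2 + h 2" using 1 by (simp add: nbs_def)
      moreover have "?\<sigma> 2 = nat (h 2 mod 3)" "?\<sigma> 1 = nat (h 1 mod 3)"
        using \<open>3 \<le> n\<close> by (simp_all add: val)
      ultimately show ?thesis
        unfolding e using free_color_mod_3[OF s s c] 1 nat_mod by metis
    next
      case 2
      then have e: "{u, v} \<in> path_edges n \<longleftrightarrow> u = n - 1" for u
        using \<open>3 \<le> n\<close> by (auto simp: edge_path)
      have s: "h (n - 1) = h n + 1 \<or> h (n - 1) = h n - 1"
        using height_step_left[OF h, of n] \<open>3 \<le> n\<close> by simp
      have "nbs n v h = h (n - 1) + h (n - 1)" using 2 by (simp add: nbs_def)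
      moreover have "?\<sigma> (n - 1) = nat (h (n - 1) mod 3)" "?\<sigma> n = nat (h n mod 3)"
        using \<open>3 \<le> n\<close> by (simp_all add: val)
      ultimately show ?thesis
        unfolding e using free_color_mod_3[OF s s c] 2(1) nat_mod by metis
    next
      case 3
      then have e: "{u, v} \<in> path_edges n \<longleftrightarrow> u = v - 1 \<or> u = Suc v" for u
        by (auto simp: edge_path)
      have s: "h (v - 1) = h v + 1 \<or> h (v - 1) = h v - 1"
        "h (Suc v) = h v + 1 \<or> h (Suc v) = h v - 1"
        using height_step_left[OF h, of v] height_step[OF h, of v] 3 by simp_all
      have "nbs n v h = h (v - 1) + h (Suc v)" using 3 by (simp add: nbs_def)
      moreover have "?\<sigma> (v - 1) = nat (h (v - 1) mod 3)" "?\<sigma> v = nat (h v mod 3)"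
        "?\<sigma> (Suc v) = nat (h (Suc v) mod 3)"
        using 3 by (simp_all add: val)
      ultimately show ?thesis
        unfolding e using free_color_mod_3[OF s c] nat_mod by metis
    qed
    then show ?thesis by auto
  qed
  have "map_pmf (\<lambda>u. coloring_of n (if u = a then flip n v h else h)) U3
      = map_pmf (\<lambda>u. if u = a then ?\<sigma>(v := ?c) else ?\<sigma>) U3"
    by (intro map_pmf_cong refl) (simp add: fl)
  also have "\<dots> = map_pmf (\<lambda>u. if u = ?c then ?\<sigma>(v := ?c) else ?\<sigma>) U3"
    using \<open>a < 3\<close> by (intro map_if_eq_U3) (auto simp: nat_less_iff)
  also have "\<dots> = metropolis 3 n v ?\<sigma>"
    unfolding metropolis_def by (intro map_pmf_cong refl) (simp add: acc)
  finally show ?thesis .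
qed

section \<open>A coupling that keeps the gap between 0 and 6\<close>

lemma nbs_diff: "nbs n v (\<lambda>i. h' i - h i) = nbs n v h' - nbs n v h"
  by (simp add: nbs_def)

lemma nbs_mono:
  assumes "3 \<le> n" "1 \<le> v" "v \<le> n" "\<And>i. 1 \<le> i \<Longrightarrow> i \<le> n \<Longrightarrow> f i \<le> g i"
  shows "nbs n v f \<le> nbs n v g"
proof -
  have "f (v - 1) + f (Suc v) \<le> g (v - 1) + g (Suc v)" if "v \<noteq> 1" "v \<noteq> n"
    using assms that by (intro add_mono) auto
  then show ?thesis
    using assms(1-3) assms(4)[of 2] assms(4)[of "n - 1"] by (auto simp: nbs_def)
qed

definition near :: "nat \<Rightarrow> ((nat \<Rightarrow> int) \<times> (nat \<Rightarrow> int)) set" where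
  "near n = {(h, h'). height_fun n h \<and> height_fun n h' \<and> (\<forall>i\<in>{1..n}. h' i - h i \<in> {0, 2, 4, 6})}"

text \<open>
  The copies move with the same value of the random variable only where the gap is at the boundary of
  its range and both would make the same move; then the gap does not change. Everywhere else they
  never move at the same time.
\<close>

definition together :: "nat \<Rightarrow> nat \<Rightarrow> (nat \<Rightarrow> int) \<Rightarrow> (nat \<Rightarrow> int) \<Rightarrow> bool" where
  "together n v h h' \<longleftrightarrow> laplacian n v h = laplacian n v h' \<and> h' v - h v \<in> {0, 6}"

definition coupled :: "nat \<Rightarrow> nat \<Rightarrow> (nat \<Rightarrow> int) \<times> (nat \<Rightarrow> int) \<Rightarrow> ((nat \<Rightarrow> int) \<times> (nat \<Rightarrow> int)) pmf" where
  "coupled n v = (\<lambda>(h, h'). map_pmf (\<lambda>u. (if u = 0 then flip n v h else h,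
     if u = (if together n v h h' then 0 else 1) then flip n v h' else h')) U3)"

lemma map_coupled:
  assumes "p \<in> near n" "3 \<le> n" "1 \<le> v" "v \<le> n"
  shows "map_pmf (\<lambda>p. coloring_of n (fst p)) (coupled n v p) = metropolis 3 n v (coloring_of n (fst p))"
    and "map_pmf (\<lambda>p. coloring_of n (snd p)) (coupled n v p) = metropolis 3 n v (coloring_of n (snd p))"
proof -
  obtain h h' where p: "p = (h, h')" by fastforce
  have hh: "height_fun n h" "height_fun n h'" using assms(1) unfolding p near_def by auto
  show "map_pmf (\<lambda>p. coloring_of n (fst p)) (coupled n v p) = metropolis 3 n v (coloring_of n (fst p))"
    using coloring_of_flip[OF hh(1) assms(2-4), of 0]
    by (simp add: p coupled_def pmf.map_comp o_def)
  show "map_pmf (\<lambda>p. coloring_of n (snd p)) (coupled n v p) = metropolis 3 n v (coloring_of n (snd p))"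
    using coloring_of_flip[OF hh(2) assms(2-4), of "if together n v h h' then 0 else 1"]
    by (simp add: p coupled_def pmf.map_comp o_def)
qed

lemma finite_coupled: "finite (set_pmf (coupled n v p))"
  by (auto simp: coupled_def split: prod.split)

lemma set_coupled:
  "set_pmf (coupled n v (h, h')) =
    (if together n v h h' then {(h, h'), (flip n v h, flip n v h')}
     else {(h, h'), (flip n v h, h'), (h, flip n v h')})"
proof -
  have "{0..<3::nat} = {0, 1, 2}" by auto
  then show ?thesis by (auto simp: coupled_def set_pmf_of_set)
qed

text \<open>
  If exactly one copy moves, the gap changes by at most 2, so it can leave the range only from 0 or 6.
  There the order of the neighboring heights, which gives the two bounds on \<open>L' - L\<close>, orders the
  Laplacians, and a move of one copy alone never narrows a gap 0 or widens a gap 6.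
\<close>

lemma gap_stays_in_range:
  fixes D L L' :: int
  assumes "D \<in> {0, 2, 4, 6}" "L \<in> {-2, 0, 2}" "L' \<in> {-2, 0, 2}"
    and "- 2 * D \<le> L' - L" "L' - L \<le> 12 - 2 * D" "\<not> (L = L' \<and> D \<in> {0, 6})"
  shows "D - L \<in> {0, 2, 4, 6}" "D + L' \<in> {0, 2, 4, 6}"
  using assms by (elim insertE emptyE; simp)+

lemma coupled_near:
  assumes "p \<in> near n" "3 \<le> n" "1 \<le> v" "v \<le> n"
  shows "set_pmf (coupled n v p) \<subseteq> near n"
proof -
  obtain h h' where p: "p = (h, h')" by fastforce
  have hh: "height_fun n h" "height_fun n h'" and D: "\<And>i. 1 \<le> i \<Longrightarrow> i \<le> n \<Longrightarrow> h' i - h i \<in> {0, 2, 4, 6}"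
    using assms(1) unfolding p near_def by auto
  define L where "L = laplacian n v h"
  define L' where "L' = laplacian n v h'"
  have L: "L \<in> {-2, 0, 2}" "L' \<in> {-2, 0, 2}"
    unfolding L_def L'_def using laplacian_height hh assms by blast+
  have "nbs n v h \<le> nbs n v h'"
    using D assms by (intro nbs_mono) fastforce+
  moreover have "nbs n v h' \<le> nbs n v (\<lambda>i. h i + 6)"
    using D assms by (intro nbs_mono) fastforce+
  then have "nbs n v h' \<le> nbs n v h + 12" by (simp add: nbs_def split: if_splits)
  ultimately have L_diff: "- 2 * (h' v - h v) \<le> L' - L" "L' - L \<le> 12 - 2 * (h' v - h v)"
    unfolding L_def L'_def by simp_all
  have val: "h' v - flip n v h v = (h' v - h v) - L" "flip n v h' v - h v = (h' v - h v) + L'"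
    "flip n v h' v - flip n v h v = (h' v - h v) + (L' - L)"
    unfolding flip_def L_def L'_def by simp_all
  have tg: "together n v h h' \<longleftrightarrow> L = L' \<and> h' v - h v \<in> {0, 6}"
    unfolding together_def L_def L'_def by simp
  have other: "flip n v f i = f i" if "i \<noteq> v" for f i using that by (simp add: flip_def)
  have fh: "height_fun n (flip n v h)" "height_fun n (flip n v h')"
    using height_fun_flip hh assms by blast+
  have near: "(f, f') \<in> near n"
    if "height_fun n f" "height_fun n f'" "f' v - f v \<in> {0, 2, 4, 6}" "\<And>i. i \<noteq> v \<Longrightarrow> f' i - f i = h' i - h i"
    for f f'
  proof -
    have "f' i - f i \<in> {0, 2, 4, 6}" if "1 \<le> i" "i \<le> n" for i
      using D[OF that] \<open>f' v - f v \<in> {0, 2, 4, 6}\<close> \<open>\<And>i. i \<noteq> v \<Longrightarrow> f' i - f i = h' i - h i\<close>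
      by (cases "i = v") simp_all
    then show ?thesis unfolding near_def using that(1,2) by simp
  qed
  note Dv = D[OF assms(3,4)]
  have "(flip n v h, flip n v h') \<in> near n" if "together n v h h'"
    using that Dv fh val(3) other by (intro near) (auto simp: tg)
  moreover have "(flip n v h, h') \<in> near n \<and> (h, flip n v h') \<in> near n" if "\<not> together n v h h'"
  proof
    note range = gap_stays_in_range[OF Dv L L_diff that[unfolded tg]]
    show "(flip n v h, h') \<in> near n"
      by (rule near[OF fh(1) hh(2)], unfold val(1), rule range(1)) (simp add: other)
    show "(h, flip n v h') \<in> near n"
      by (rule near[OF hh(1) fh(2)], unfold val(2), rule range(2)) (simp add: other)
  qed
  ultimately show ?thesis
    unfolding p set_coupled using assms(1) p by simp
qed

section \<open>A martingale and a potential that contracts\<close>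

text \<open>
  The weights in force just before the update of \<open>v\<close>, summed edge by edge: the more recently updated
  endpoint has weight 3, the other one weight 1. After a full sweep, this is the right endpoint of
  each edge, and during the sweep the only exception is the edge from \<open>v - 1\<close> to \<open>v\<close>.
\<close>

definition weighted_gap :: "nat \<Rightarrow> nat \<Rightarrow> (nat \<Rightarrow> int) \<Rightarrow> int" where
  "weighted_gap n v D = (\<Sum>i\<in>{1..<n}. if Suc i = v then 3 * D i + D (Suc i) else D i + 3 * D (Suc i))"

text \<open>
  The increment vanishes when \<open>d\<close> is \<open>(D v + nbs n v D) / 3\<close>, the expected new gap at \<open>v\<close> under
  every coupling of the two updates. This is the martingale property.
\<close>

lemma weighted_gap_update:
  assumes "3 \<le> n" "1 \<le> v" "v \<le> n"
  shows "weighted_gap n (Suc v) (D(v := d))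
    = weighted_gap n v D + (if v = 1 \<or> v = n then 1 else 2) * (3 * d - D v - nbs n v D)"
proof -
  have "weighted_gap n (Suc v) (D(v := d)) - weighted_gap n v D
      = (\<Sum>i\<in>{1..<n}. (if i = v - 1 then 3 * d - D v - 2 * D (v - 1) else 0)
          + (if i = v then 3 * d - D v - 2 * D (Suc v) else 0))"
    unfolding weighted_gap_def sum_subtractf[symmetric] using assms
    by (intro sum.cong refl) auto
  also have "\<dots> = (if v = 1 \<or> v = n then 1 else 2) * (3 * d - D v - nbs n v D)"
    using assms by (auto simp: sum.distrib nbs_def numeral_2_eq_2)
  finally show ?thesis by simp
qed

text \<open>
  Here \<open>24 * (n - 1)\<close> is the weighted gap of the constant gap 6.
\<close>

definition potential :: "nat \<Rightarrow> nat \<Rightarrow> (nat \<Rightarrow> int) \<times> (nat \<Rightarrow> int) \<Rightarrow> real" where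
  "potential n v = (\<lambda>(h, h'). let S = weighted_gap n v (\<lambda>i. h' i - h i)
     in of_int (S * (24 * (int n - 1) - S)))"

lemma expectation_U3: "measure_pmf.expectation U3 f = (f 0 + f 1 + f 2 :: real) / 3"
proof -
  have "{0..<3::nat} = {0, 1, 2}" by auto
  then show ?thesis by (subst integral_pmf_of_set) auto
qed

text \<open>
  For a martingale \<open>S\<close>, the mean of \<open>S (M - S)\<close> decreases by the mean of the squared increments. If
  the copies move separately, the three equally likely increments are \<open>g\<close> times \<open>- 2 L - L'\<close>,
  \<open>L + 2 L'\<close> and \<open>L - L'\<close>, where \<open>g\<close> is the number of neighbors of \<open>v\<close>.
\<close>

lemma potential_coupled:
  fixes h h' :: "nat \<Rightarrow> int"
  assumes "3 \<le> n" "1 \<le> v" "v \<le> n"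
  defines "L \<equiv> laplacian n v h" and "L' \<equiv> laplacian n v h'"
    and "g \<equiv> (if v = 1 \<or> v = n then 1 else 2 :: int)"
  shows "measure_pmf.expectation (coupled n v (h, h')) (potential n (Suc v)) =
    potential n v (h, h') - (if together n v h h' then 0 else of_int (2 * g\<^sup>2 * (L\<^sup>2 + L * L' + L'\<^sup>2)))"
proof -
  define D where "D = (\<lambda>i. h' i - h i)"
  define S where "S = weighted_gap n v D"
  define M where "M = 24 * (int n - 1)"
  have N: "nbs n v D = 2 * D v + L' - L"
    unfolding D_def nbs_diff L_def L'_def by simp
  have upd: "weighted_gap n (Suc v) (D(v := d)) = S + g * (3 * d - 3 * D v - L' + L)" for d
    using weighted_gap_update[OF assms(1-3), of D d] unfolding S_def g_def N by (simp add: algebra_simps)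
  have d: "(\<lambda>i. h' i - flip n v h i) = D(v := D v - L)"
    "(\<lambda>i. flip n v h' i - h i) = D(v := D v + L')"
    "(\<lambda>i. flip n v h' i - flip n v h i) = D(v := D v + L' - L)"
    "(\<lambda>i. h' i - h i) = D(v := D v)"
    unfolding D_def L_def L'_def flip_def by auto
  have pot: "potential n (Suc v) (f, f') = of_int ((S + x) * (M - S - x))"
    if "(\<lambda>i. f' i - f i) = D(v := d)" "g * (3 * d - 3 * D v - L' + L) = x" for f f' d x
    unfolding potential_def Let_def M_def[symmetric] using that upd[of d] by (simp add: algebra_simps)
  have pv: "potential n v (h, h') = of_int (S * (M - S))"
    unfolding potential_def Let_def M_def S_def D_def by simp
  show ?thesis
  proof (cases "together n v h h'")
    case True
    then have "L = L'" unfolding together_def L_def L'_def by simp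
    have "potential n (Suc v) (h, h') = of_int (S * (M - S))"
      using pot[OF d(4)] \<open>L = L'\<close> by simp
    moreover have "potential n (Suc v) (flip n v h, flip n v h') = of_int (S * (M - S))"
      using pot[OF d(3)] \<open>L = L'\<close> by simp
    ultimately show ?thesis
      using True pv by (simp add: coupled_def expectation_U3)
  next
    case False
    have "measure_pmf.expectation (coupled n v (h, h')) (potential n (Suc v)) =
      (potential n (Suc v) (flip n v h, h') + potential n (Suc v) (h, flip n v h')
        + potential n (Suc v) (h, h')) / 3"
      using False by (simp add: coupled_def expectation_U3)
    also have "\<dots> = potential n v (h, h') - of_int (2 * g\<^sup>2 * (L\<^sup>2 + L * L' + L'\<^sup>2))"
      unfolding pot[OF d(1) refl] pot[OF d(2) refl] pot[OF d(4) refl] pv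
      by (simp add: field_simps power2_eq_square)
    finally show ?thesis using False by simp
  qed
qed

text \<open>
  The updates that leave the gap unchanged with certainty: either both copies move together or neither
  can move.
\<close>

definition frozen :: "nat \<Rightarrow> nat \<Rightarrow> (nat \<Rightarrow> int) \<times> (nat \<Rightarrow> int) \<Rightarrow> bool" where
  "frozen n v = (\<lambda>(h, h'). laplacian n v h = laplacian n v h' \<and>
     (laplacian n v h = 0 \<or> h' v - h v \<in> {0, 6}))"

lemma potential_coupled_le:
  assumes "p \<in> near n" "3 \<le> n" "1 \<le> v" "v \<le> n"
  shows "measure_pmf.expectation (coupled n v p) (potential n (Suc v))
    \<le> potential n v p - (if frozen n v p then 0 else 8)"
proof -
  obtain h h' where p: "p = (h, h')" by fastforce
  have hh: "height_fun n h" "height_fun n h'" using assms(1) unfolding p near_def by auto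
  define L where "L = laplacian n v h"
  define L' where "L' = laplacian n v h'"
  define g where "g = (if v = 1 \<or> v = n then 1 else 2 :: int)"
  have L: "L \<in> {-2, 0, 2}" "L' \<in> {-2, 0, 2}"
    unfolding L_def L'_def using laplacian_height hh assms by blast+
  have fr: "frozen n v p \<longleftrightarrow> L = L' \<and> (L = 0 \<or> h' v - h v \<in> {0, 6})"
    unfolding frozen_def p L_def L'_def by simp
  have tg: "together n v h h' \<longleftrightarrow> L = L' \<and> h' v - h v \<in> {0, 6}"
    unfolding together_def L_def L'_def by simp
  define Q where "Q = 2 * g\<^sup>2 * (L\<^sup>2 + L * L' + L'\<^sup>2)"
  have "8 \<le> Q" if "L \<noteq> 0 \<or> L' \<noteq> 0"
    using L that unfolding Q_def g_def by auto
  moreover have "0 \<le> Q"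
    using L unfolding Q_def g_def by auto
  ultimately have "(if frozen n v p then 0 else 8)
      \<le> (if together n v h h' then 0 else Q)"
    by (auto simp: fr tg)
  then have "real_of_int (if frozen n v p then 0 else 8)
      \<le> real_of_int (if together n v h h' then 0 else Q)"
    by (rule iffD2[OF of_int_le_iff])
  then show ?thesis
    unfolding p potential_coupled[OF assms(2-4), of h h', folded L_def L'_def g_def, folded Q_def]
    by (auto split: if_splits)
qed

lemma frozen_coupled_gap:
  assumes "frozen n v (h, h')" "(f, f') \<in> set_pmf (coupled n v (h, h'))"
  shows "f' i - f i = h' i - h i"
proof (cases "together n v h h'")
  case True
  then show ?thesis using assms(2) by (auto simp: set_coupled together_def flip_def)
next
  case False
  then have "laplacian n v h = 0" "laplacian n v h' = 0"
    using assms(1) by (auto simp: frozen_def together_def)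
  then have "flip n v h = h" "flip n v h' = h'" by (simp_all add: flip_def fun_eq_iff)
  then show ?thesis using assms(2) False by (simp add: set_coupled)
qed

lemma expectation_sweep_coupled:
  "v \<le> n \<Longrightarrow> measure_pmf.expectation (sweep (coupled n) [v..<Suc n] p) f
    = measure_pmf.expectation (coupled n v p)
        (\<lambda>p. measure_pmf.expectation (sweep (coupled n) [Suc v..<Suc n] p) f)" for f :: "_ \<Rightarrow> real"
  by (simp add: upt_conv_Cons expectation_bind_finite finite_coupled finite_set_sweep del: upt_Suc)

lemma sweep_potential_le:
  assumes "3 \<le> n" "1 \<le> v" "v \<le> Suc n" "p \<in> near n"
  shows "measure_pmf.expectation (sweep (coupled n) [v..<Suc n] p) (potential n (Suc n))
    \<le> potential n v p"
  using assms(3,2,4)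
proof (induction v arbitrary: p rule: inc_induct)
  case (step v)
  have "measure_pmf.expectation (sweep (coupled n) [v..<Suc n] p) (potential n (Suc n))
      = measure_pmf.expectation (coupled n v p)
          (\<lambda>p. measure_pmf.expectation (sweep (coupled n) [Suc v..<Suc n] p) (potential n (Suc n)))"
    using step.hyps by (simp add: expectation_sweep_coupled del: upt_Suc)
  also have "\<dots> \<le> measure_pmf.expectation (coupled n v p) (potential n (Suc v))"
    using coupled_near[of p n v] step.prems step.hyps \<open>3 \<le> n\<close>
    by (intro expectation_mono_finite finite_coupled step.IH) auto
  also have "\<dots> \<le> potential n v p"
    using potential_coupled_le[of p n v] step.prems step.hyps \<open>3 \<le> n\<close> by (simp split: if_splits)
  finally show ?case .
qed simp

lemma sweep_potential_drop_if_active: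
  assumes "3 \<le> n" "1 \<le> v" "v \<le> n" "p \<in> near n" "\<not> frozen n v p"
  shows "measure_pmf.expectation (sweep (coupled n) [v..<Suc n] p) (potential n (Suc n))
    \<le> potential n v p - 8"
proof -
  have "measure_pmf.expectation (sweep (coupled n) [v..<Suc n] p) (potential n (Suc n))
      \<le> measure_pmf.expectation (coupled n v p) (potential n (Suc v))"
    using coupled_near[of p n v] sweep_potential_le[of n "Suc v"] assms
    by (auto simp: expectation_sweep_coupled simp del: upt_Suc
        intro!: expectation_mono_finite finite_coupled)
  also have "\<dots> \<le> potential n v p - 8"
    using potential_coupled_le[of p n v] assms by simp
  finally show ?thesis .
qed

text \<open>
  As long as the updates are frozen, the gap is preserved and so is its Laplacian at the
  vertices still to come. A vertex where this Laplacian is not zero is not frozen, so the first update that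
  is not frozen comes within the sweep and yields the drop by 8.
\<close>

lemma sweep_potential_drop_if_not_harmonic:
  assumes "3 \<le> n" "1 \<le> v" "v \<le> n" "p \<in> near n"
    and "\<exists>u\<in>{v..n}. laplacian n u (\<lambda>i. snd p i - fst p i) \<noteq> 0"
  shows "measure_pmf.expectation (sweep (coupled n) [v..<Suc n] p) (potential n (Suc n))
    \<le> potential n v p - 8"
  using assms(3,2,4,5)
proof (induction v arbitrary: p rule: inc_induct)
  case base
  then have "\<not> frozen n n p"
    by (auto simp: frozen_def nbs_diff algebra_simps split: prod.splits)
  then show ?case using sweep_potential_drop_if_active[of n n p] base \<open>3 \<le> n\<close> by simp
next
  case (step v)
  show ?case
  proof (cases "frozen n v p")
    case False
    then show ?thesis using sweep_potential_drop_if_active[of n v p] step \<open>3 \<le> n\<close> by simp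
  next
    case True
    then have "laplacian n v (\<lambda>i. snd p i - fst p i) = 0"
      by (auto simp: frozen_def nbs_diff split: prod.splits)
    then obtain u where u: "u \<in> {Suc v..n}" "laplacian n u (\<lambda>i. snd p i - fst p i) \<noteq> 0"
      using step.prems(3) by (metis atLeastAtMost_iff le_neq_implies_less Suc_leI)
    have same: "(\<lambda>i. snd r i - fst r i) = (\<lambda>i. snd p i - fst p i)"
      if "r \<in> set_pmf (coupled n v p)" for r
      using frozen_coupled_gap[of n v "fst p" "snd p" "fst r" "snd r"] True that by auto
    have "measure_pmf.expectation (sweep (coupled n) [v..<Suc n] p) (potential n (Suc n))
        \<le> measure_pmf.expectation (coupled n v p) (\<lambda>r. potential n (Suc v) r - 8)"
      unfolding expectation_sweep_coupled[OF less_imp_le[OF step.hyps(2)]]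
    proof (intro expectation_mono_finite finite_coupled)
      fix r assume r: "r \<in> set_pmf (coupled n v p)"
      show "measure_pmf.expectation (sweep (coupled n) [Suc v..<Suc n] r) (potential n (Suc n))
          \<le> potential n (Suc v) r - 8"
      proof (intro step.IH)
        have "laplacian n u (\<lambda>i. snd r i - fst r i) \<noteq> 0"
          using u(2) fun_cong[OF same[OF r], of u] unfolding same[OF r] by simp
        then show "\<exists>u\<in>{Suc v..n}. laplacian n u (\<lambda>i. snd r i - fst r i) \<noteq> 0"
          using u(1) by blast
      qed (use r coupled_near[of p n v] step.prems step.hyps \<open>3 \<le> n\<close> in auto)
    qed
    also have "\<dots> = measure_pmf.expectation (coupled n v p) (potential n (Suc v)) - 8"
      by (simp add: integrable_measure_pmf_finite finite_coupled)
    also have "\<dots> \<le> potential n v p - 8"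
      using potential_coupled_le[of p n v] step.prems step.hyps \<open>3 \<le> n\<close> by (simp split: if_splits)
    finally show ?thesis .
  qed
qed

text \<open>
  At the left end the equation says that the gap is initially flat, and the interior equations carry
  this slope along the path.
\<close>

lemma harmonic_const:
  assumes "3 \<le> n" "\<And>u. u \<in> {1..n} \<Longrightarrow> laplacian n u D = 0" "i \<in> {1..n}"
  shows "D i = D 1"
proof -
  have step: "D (Suc i) = D i" if "1 \<le> i" "i < n" for i
    using that
  proof (induction i rule: dec_induct)
    case base
    then show ?case using assms(1) assms(2)[of 1] by (simp add: nbs_def numeral_2_eq_2)
  next
    case (step i)
    then show ?case using assms(1) assms(2)[of "Suc i"] by (simp add: nbs_def)
  qed
  have "1 \<le> i" "i \<le> n" using assms(3) by auto
  then show ?thesis by (induction i rule: dec_induct) (auto simp: step)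
qed

text \<open>
  For a constant gap 2 or 4 it is the first update that is not frozen.
\<close>

lemma potential_drop_scan:
  assumes "3 \<le> n" "p \<in> near n" "potential n 1 p \<noteq> 0"
  shows "measure_pmf.expectation (sweep (coupled n) [1..<Suc n] p) (potential n (Suc n))
    \<le> potential n 1 p - 8"
proof (cases "\<exists>u\<in>{1..n}. laplacian n u (\<lambda>i. snd p i - fst p i) \<noteq> 0")
  case True
  then show ?thesis using sweep_potential_drop_if_not_harmonic[of n 1 p] assms by simp
next
  case False
  obtain h h' where p: "p = (h, h')" by fastforce
  define d where "d = h' 1 - h 1"
  have const: "h' i - h i = d" if "i \<in> {1..n}" for i
    using harmonic_const[OF assms(1) _ that, of "\<lambda>i. h' i - h i"] False unfolding d_def p by auto
  have "weighted_gap n 1 (\<lambda>i. h' i - h i) = (\<Sum>i\<in>{1..<n}. 4 * d)"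
    unfolding weighted_gap_def by (intro sum.cong refl) (auto simp: const)
  also have "\<dots> = 4 * (int n - 1) * d" using assms(1) by (simp add: of_nat_diff)
  finally have gap: "weighted_gap n 1 (\<lambda>i. h' i - h i) = 4 * (int n - 1) * d" .
  have "d \<noteq> 0 \<and> d \<noteq> 6"
    using assms(3) unfolding potential_def p case_prod_conv Let_def gap by auto
  moreover have "laplacian n 1 h \<noteq> 0"
    using laplacian_end_nonzero[of n h] assms(1,2) unfolding p near_def by auto
  ultimately have "\<not> frozen n 1 p"
    unfolding frozen_def p d_def by auto
  then show ?thesis using sweep_potential_drop_if_active[of n 1 p] assms by simp
qed

text \<open>
  After the update of \<open>n\<close> the weights are those at the start of the sweep, so the potentials of
  successive sweeps can be compared.
\<close>

lemma weighted_gap_end: "weighted_gap n (Suc n) D = weighted_gap n 1 D"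
  unfolding weighted_gap_def by (intro sum.cong refl) auto

lemma potential_end: "potential n (Suc n) = potential n 1"
  unfolding potential_def weighted_gap_end ..

text \<open>
  The second factor of the potential is the weighted gap of \<open>6 - D\<close>, so facts about the first factor
  apply to both.
\<close>

lemma weighted_gap_complement:
  assumes "1 \<le> n"
  shows "24 * (int n - 1) - weighted_gap n 1 D = weighted_gap n 1 (\<lambda>i. 6 - D i)"
proof -
  have "weighted_gap n 1 D + weighted_gap n 1 (\<lambda>i. 6 - D i) = (\<Sum>i\<in>{1..<n}. 24)"
    unfolding weighted_gap_def sum.distrib[symmetric] by (intro sum.cong refl) auto
  also have "\<dots> = 24 * (int n - 1)" using assms by (simp add: of_nat_diff)
  finally show ?thesis by simp
qed

lemma weighted_gap_nonneg:
  assumes "\<And>i. i \<in> {1..n} \<Longrightarrow> 0 \<le> D i"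
  shows "0 \<le> weighted_gap n v D"
  unfolding weighted_gap_def using assms by (intro sum_nonneg) auto

lemma weighted_gap_pos:
  assumes "2 \<le> n" "\<And>i. i \<in> {1..n} \<Longrightarrow> 0 \<le> D i" "j \<in> {1..n}" "D j \<noteq> 0"
  shows "0 < weighted_gap n v D"
proof -
  let ?f = "\<lambda>i. if Suc i = v then 3 * D i + D (Suc i) else D i + 3 * D (Suc i)"
  have "\<exists>i\<in>{1..<n}. j = i \<or> j = Suc i"
    using assms(1,3) by (intro bexI[of _ "if j = n then n - 1 else j"]) auto
  then obtain i where i: "i \<in> {1..<n}" "j = i \<or> j = Suc i" by blast
  have "0 \<le> D i" "0 \<le> D (Suc i)" "0 < D j" using assms(2)[of i] assms(2)[of "Suc i"] assms(2)[of j] assms(3,4) i by auto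
  then have "0 < ?f i" using i(2) by auto
  moreover have "0 \<le> ?f k" if "k \<in> {1..<n}" for k
    using assms(2)[of k] assms(2)[of "Suc k"] that by auto
  ultimately show ?thesis
    unfolding weighted_gap_def using i(1) by (intro sum_pos2[of _ i]) auto
qed

text \<open>
  The upper bound is the inequality \<open>4 S R \<le> (S + R)\<^sup>2\<close> for the two factors \<open>S\<close> and \<open>R\<close>, whose sum is
  fixed. For the last claim, a vertex where the colors differ has a gap other than 0 and 6, which
  makes both integer factors positive.
\<close>

lemma potential_bounds:
  assumes "3 \<le> n" "p \<in> near n"
  shows "0 \<le> potential n 1 p" "potential n 1 p \<le> 144 * (real n)\<^sup>2"
    and "coloring_of n (fst p) \<noteq> coloring_of n (snd p) \<Longrightarrow> 1 \<le> potential n 1 p"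
proof -
  obtain h h' where p: "p = (h, h')" by fastforce
  define D where "D = (\<lambda>i. h' i - h i)"
  define S where "S = weighted_gap n 1 D"
  define R where "R = weighted_gap n 1 (\<lambda>i. 6 - D i)"
  have D: "D i \<in> {0, 2, 4, 6}" if "i \<in> {1..n}" for i
    using assms(2) that unfolding p near_def D_def by auto
  have D': "0 \<le> D i" "0 \<le> 6 - D i" if "i \<in> {1..n}" for i
    using D[OF that] by auto
  have R: "24 * (int n - 1) - S = R"
    unfolding S_def R_def using assms(1) by (intro weighted_gap_complement) simp
  have pot: "potential n 1 p = of_int (S * R)"
    unfolding potential_def p case_prod_conv Let_def
    unfolding D_def[symmetric] unfolding S_def[symmetric] R ..
  have "0 \<le> S" "0 \<le> R"
    unfolding S_def R_def using D' by (auto intro: weighted_gap_nonneg)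
  then show "0 \<le> potential n 1 p" unfolding pot by simp
  have "4 * (S * R) \<le> (S + R)\<^sup>2"
    using zero_le_power2[of "S - R"] by (simp add: power2_eq_square algebra_simps)
  also have "(S + R)\<^sup>2 = (24 * (int n - 1))\<^sup>2" using R by (intro arg_cong[of _ _ "\<lambda>x. x\<^sup>2"]) linarith
  also have "\<dots> \<le> (24 * int n)\<^sup>2" using assms(1) by (intro power_mono) auto
  finally have "S * R \<le> 144 * (int n)\<^sup>2" by (simp add: power_mult_distrib mult.commute)
  then have "real_of_int (S * R) \<le> real_of_int (144 * (int n)\<^sup>2)" by (rule iffD2[OF of_int_le_iff])
  then show "potential n 1 p \<le> 144 * (real n)\<^sup>2" unfolding pot by simp
  show "1 \<le> potential n 1 p" if "coloring_of n (fst p) \<noteq> coloring_of n (snd p)"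
  proof -
    have "\<exists>j\<in>{1..n}. h j mod 3 \<noteq> h' j mod 3"
    proof (rule ccontr)
      assume "\<not> (\<exists>j\<in>{1..n}. h j mod 3 \<noteq> h' j mod 3)"
      then have "coloring_of n h = coloring_of n h'"
        unfolding coloring_of_def by (intro restrict_ext) simp
      with that show False by (simp add: p)
    qed
    then obtain j where j: "j \<in> {1..n}" "h j mod 3 \<noteq> h' j mod 3" by blast
    have "(h j + 6) mod 3 = h j mod 3" using mod_mult_self1[of "h j" 2 3] by simp
    then have "h' j \<noteq> h j" "h' j \<noteq> h j + 6" using j(2) by metis+
    then have "D j \<noteq> 0" "6 - D j \<noteq> 0"
      unfolding D_def by linarith+
    then have "0 < S" "0 < R"
      unfolding S_def R_def using D' j(1) assms(1) by (auto intro!: weighted_gap_pos[of n _ j])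
    then have "1 \<le> S * R" by (simp add: int_one_le_iff_zero_less)
    then show ?thesis unfolding pot by (metis of_int_1 of_int_le_iff)
  qed
qed

lemma map_steps_coupled:
  assumes "p \<in> near n" "3 \<le> n"
  shows "map_pmf (\<lambda>p. coloring_of n (fst p)) (steps (sweep (coupled n) [1..<Suc n]) t p)
      = steps (systematic_scan 3 n) t (coloring_of n (fst p))"
    and "map_pmf (\<lambda>p. coloring_of n (snd p)) (steps (sweep (coupled n) [1..<Suc n]) t p)
      = steps (systematic_scan 3 n) t (coloring_of n (snd p))"
    and "set_pmf (steps (sweep (coupled n) [1..<Suc n]) t p) \<subseteq> near n"
proof -
  have vs: "set [1..<Suc n] = {1..n}" by auto
  have closed: "set_pmf (sweep (coupled n) [1..<Suc n] p) \<subseteq> near n" if "p \<in> near n" for p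
    using that assms(2) by (intro sweep_closed coupled_near) (auto simp del: upt_Suc)
  then show "set_pmf (steps (sweep (coupled n) [1..<Suc n]) t p) \<subseteq> near n"
    using assms(1) by (intro steps_closed)
  show "map_pmf (\<lambda>p. coloring_of n (fst p)) (steps (sweep (coupled n) [1..<Suc n]) t p)
      = steps (systematic_scan 3 n) t (coloring_of n (fst p))"
    unfolding systematic_scan_eq_sweep using closed assms
    by (intro map_steps_semiconj[where A = "near n"] map_sweep_semiconj[where A = "near n"]
        coupled_near map_coupled) (auto simp del: upt_Suc)
  show "map_pmf (\<lambda>p. coloring_of n (snd p)) (steps (sweep (coupled n) [1..<Suc n]) t p)
      = steps (systematic_scan 3 n) t (coloring_of n (snd p))"
    unfolding systematic_scan_eq_sweep using closed assms
    by (intro map_steps_semiconj[where A = "near n"] map_sweep_semiconj[where A = "near n"]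
        coupled_near map_coupled) (auto simp del: upt_Suc)
qed

lemma potential_contracts:
  assumes "3 \<le> n" "p \<in> near n"
  shows "measure_pmf.expectation (sweep (coupled n) [1..<Suc n] p) (potential n 1)
    \<le> (1 - 1 / (18 * (real n)\<^sup>2)) * potential n 1 p"
proof (cases "potential n 1 p = 0")
  case True
  then show ?thesis
    using sweep_potential_le[of n 1 p] assms by (simp add: potential_end del: upt_Suc)
next
  case False
  have "potential n 1 p / (18 * (real n)\<^sup>2) \<le> 8"
    using potential_bounds(2)[OF assms] assms(1) by (simp add: divide_le_eq)
  then show ?thesis
    using potential_drop_scan[OF assms False] unfolding potential_end left_diff_distrib by simp
qed

lemma d_TV_near:
  assumes "3 \<le> n" "p \<in> near n"
  shows "d_TV (proper_colorings 3 n) (steps (systematic_scan 3 n) t (coloring_of n (fst p)))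
      (steps (systematic_scan 3 n) t (coloring_of n (snd p)))
    \<le> (1 - 1 / (18 * (real n)\<^sup>2)) ^ t * (144 * (real n)\<^sup>2)"
proof -
  let ?C = "steps (sweep (coupled n) [1..<Suc n]) t p" and ?\<rho> = "1 - 1 / (18 * (real n)\<^sup>2)"
  have "1 \<le> (real n)\<^sup>2" using assms(1) by (intro one_le_power) simp
  then have \<rho>: "0 \<le> ?\<rho>" by (simp add: divide_le_eq)
  have "d_TV (proper_colorings 3 n) (steps (systematic_scan 3 n) t (coloring_of n (fst p)))
      (steps (systematic_scan 3 n) t (coloring_of n (snd p)))
    \<le> measure_pmf.expectation ?C (potential n 1)"
    unfolding map_steps_coupled(1,2)[OF assms(2,1), symmetric]
    using map_steps_coupled(3)[OF assms(2,1), of t] potential_bounds(1,3)[OF assms(1)]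
    by (intro d_TV_le_expectation_coupling finite_proper_colorings finite_set_steps finite_set_sweep finite_coupled) auto
  also have "\<dots> \<le> ?\<rho> ^ t * potential n 1 p"
    using assms \<rho> map_steps_coupled(3)[OF _ assms(1), of _ 1]
    by (intro expectation_steps_contract[where A = "near n"] potential_contracts finite_set_sweep finite_coupled)
      (auto simp: bind_return_pmf simp del: upt_Suc)
  also have "\<dots> \<le> ?\<rho> ^ t * (144 * (real n)\<^sup>2)"
    using potential_bounds(2)[OF assms] \<rho> by (intro mult_left_mono zero_le_power)
  finally show ?thesis .
qed

section \<open>Chains of close pairs between arbitrary colorings\<close>

text \<open>
  Adjacent colors differ by 1 or -1 modulo 3, and the lift adds up these differences.
\<close>

lemma exists_height:
  assumes "\<sigma> \<in> proper_colorings 3 n"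
  obtains h where "height_fun n h" "coloring_of n h = \<sigma>" "h 1 = int (\<sigma> 1)"
proof
  define \<delta> :: "nat \<Rightarrow> int" where "\<delta> j = (if \<sigma> (Suc j) = (\<sigma> j + 1) mod 3 then 1 else - 1)" for j
  define h where "h i = int (\<sigma> 1) + (\<Sum>j\<in>{1..<i}. \<delta> j)" for i
  have step: "h (Suc i) = h i + \<delta> i" if "1 \<le> i" for i
    unfolding h_def using that by simp
  show "height_fun n h" unfolding height_fun_def by (simp add: step) (simp add: \<delta>_def)
  show "h 1 = int (\<sigma> 1)" by (simp add: h_def)
  have lt: "\<sigma> i < 3" if "1 \<le> i" "i \<le> n" for i
    using assms that unfolding proper_colorings_def by auto
  have ne: "\<sigma> (Suc i) \<noteq> \<sigma> i" if "1 \<le> i" "i < n" for i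
  proof -
    have "{Suc i, i} \<in> path_edges n" using that by (simp add: edge_path)
    then show ?thesis using assms unfolding proper_colorings_def by blast
  qed
  have "h i mod 3 = int (\<sigma> i)" if "1 \<le> i" "i \<le> n" for i
    using that
  proof (induction i rule: dec_induct)
    case base
    then show ?case using lt[of 1] by (simp add: h_def)
  next
    case (step i)
    have "h (Suc i) mod 3 = (h i mod 3 + \<delta> i) mod 3"
      using step.hyps by (simp add: \<open>\<And>i. 1 \<le> i \<Longrightarrow> h (Suc i) = h i + \<delta> i\<close> mod_simps)
    also have "\<dots> = (int (\<sigma> i) + \<delta> i) mod 3" using step by simp
    also have "\<dots> = int (\<sigma> (Suc i))"
    proof -
      have "\<sigma> i = 0 \<or> \<sigma> i = 1 \<or> \<sigma> i = 2" "\<sigma> (Suc i) = 0 \<or> \<sigma> (Suc i) = 1 \<or> \<sigma> (Suc i) = 2"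
        using lt[of i] lt[of "Suc i"] step by auto
      then show ?thesis using ne[of i] step unfolding \<delta>_def by (elim disjE) simp_all
    qed
    finally show ?case .
  qed
  moreover have "\<sigma> i = undefined" if "i \<notin> {1..n}" for i
    using assms that unfolding proper_colorings_def by (auto simp: PiE_def extensional_def)
  ultimately show "coloring_of n h = \<sigma>"
    unfolding coloring_of_def by (auto simp: fun_eq_iff restrict_def)
qed

lemma height_dist:
  assumes "height_fun n h" "1 \<le> i" "i \<le> n"
  shows "\<bar>h i - h 1\<bar> \<le> int n"
proof -
  have "\<bar>h i - h 1\<bar> \<le> int i"
    using assms(2,3)
  proof (induction i rule: dec_induct)
    case (step i)
    then show ?case using height_step[OF assms(1), of i] by auto
  qed simp
  then show ?thesis using assms(3) by simp
qed

lemma height_parity: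
  assumes "height_fun n h" "height_fun n g" "even (g 1 - h 1)" "1 \<le> i" "i \<le> n"
  shows "even (g i - h i)"
  using assms(4,5)
proof (induction i rule: dec_induct)
  case base
  then show ?case using assms(3) by simp
next
  case (step i)
  then show ?case using height_step[OF assms(1), of i] height_step[OF assms(2), of i] by auto
qed

text \<open>
  Because of the equal parity, one function can overtake the other only at a vertex where they agree,
  so the minimum takes no other steps than these two.
\<close>

lemma height_fun_min:
  assumes h: "height_fun n h" and g: "height_fun n g" and par: "even (g 1 - h 1)"
  shows "height_fun n (\<lambda>i. min (h i) (g i))"
  unfolding height_fun_def
proof (intro allI impI)
  fix i assume i: "1 \<le> i \<and> i < n"
  have "even (g i - h i)" using height_parity[OF assms, of i] i by simp
  then obtain m where "g i - h i = 2 * m" by (rule evenE)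
  then have "g i = h i + 2 * m" by simp
  moreover have "m \<le> - 1 \<or> m = 0 \<or> 1 \<le> m" by linarith
  ultimately show "\<bar>min (h (Suc i)) (g (Suc i)) - min (h i) (g i)\<bar> = 1"
    using height_step[OF h, of i] height_step[OF g, of i] i by auto
qed

text \<open>
  Raising a lift of \<open>\<tau>\<close> by a multiple of 3 keeps its coloring. The multiple is chosen so large that the
  lift lies above that of \<open>\<sigma>\<close>, with its parity adjusted to make all gaps even.
\<close>

lemma near_chain:
  assumes "3 \<le> n" "\<sigma> \<in> proper_colorings 3 n" "\<tau> \<in> proper_colorings 3 n"
  obtains z where "coloring_of n (z 0) = \<sigma>" "coloring_of n (z (2 * n)) = \<tau>"
    and "\<And>j. (z j, z (Suc j)) \<in> near n"
proof -
  obtain h where h: "height_fun n h" "coloring_of n h = \<sigma>" "h 1 = int (\<sigma> 1)"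
    using exists_height[OF assms(2)] .
  obtain f where f: "height_fun n f" "coloring_of n f = \<tau>" "f 1 = int (\<tau> 1)"
    using exists_height[OF assms(3)] .
  have lt: "\<sigma> 1 < 3" "\<tau> 1 < 3"
    using assms unfolding proper_colorings_def by auto
  define k where "k = (if even (f 1 - h 1) then 2 * int n else 2 * int n + 1)"
  define g where "g i = f i + 3 * k" for i
  have g: "height_fun n g" using f(1) unfolding height_fun_def g_def by simp
  have col_g: "coloring_of n g = \<tau>" unfolding f(2)[symmetric] coloring_of_def g_def by simp
  have par: "even (g 1 - h 1)" unfolding g_def k_def by auto
  have range: "h i \<le> g i" "g i \<le> h i + 12 * int n" if "1 \<le> i" "i \<le> n" for i
    using height_dist[OF h(1) that] height_dist[OF f(1) that] lt h(3) f(3) assms(1)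
    unfolding g_def k_def by (auto split: if_splits)
  (* h, raised by 6 j and cut off at g *)
  define z where "z j i = min (h i + 6 * int j) (g i)" for j i
  have height: "height_fun n (z j)" for j
  proof -
    have "height_fun n (\<lambda>i. h i + 6 * int j)" using h(1) unfolding height_fun_def by simp
    then show ?thesis unfolding z_def using g par by (intro height_fun_min) auto
  qed
  show thesis
  proof (rule that)
    show "coloring_of n (z 0) = \<sigma>"
      unfolding h(2)[symmetric] coloring_of_def using range by (intro restrict_ext) (simp add: z_def)
    show "coloring_of n (z (2 * n)) = \<tau>"
      unfolding col_g[symmetric] coloring_of_def using range by (intro restrict_ext) (simp add: z_def min_absorb2)
    show "(z j, z (Suc j)) \<in> near n" for j
    proof -
      have "z (Suc j) i - z j i \<in> {0, 2, 4, 6}" if "1 \<le> i" "i \<le> n" for i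
      proof -
        have "even (g i - h i)" using height_parity[OF h(1) g par that] .
        then obtain m where "g i - h i = 2 * m" by (rule evenE)
        then have "g i = h i + 2 * m" by simp
        moreover have "m \<le> 3 * int j \<or> m = 3 * int j + 1 \<or> m = 3 * int j + 2 \<or> 3 * int j + 3 \<le> m"
          by linarith
        ultimately show ?thesis unfolding z_def by auto
      qed
      then show ?thesis unfolding near_def using height by simp
    qed
  qed
qed

section \<open>The mixing time of the scan\<close>

lemma d_TV_stationary:
  assumes "3 \<le> n" "\<sigma> \<in> proper_colorings 3 n"
  shows "d_TV (proper_colorings 3 n) (steps (systematic_scan 3 n) t \<sigma>) (pmf_of_set (proper_colorings 3 n))
    \<le> 288 * real n ^ 3 * (1 - 1 / (18 * (real n)\<^sup>2)) ^ t"
proof (rule d_TV_stationary_le)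
  fix \<tau> assume "\<tau> \<in> proper_colorings 3 n"
  then obtain z where z: "coloring_of n (z 0) = \<sigma>" "coloring_of n (z (2 * n)) = \<tau>"
    "\<And>j. (z j, z (Suc j)) \<in> near n"
    using near_chain[OF assms] by metis
  let ?\<mu> = "\<lambda>j. steps (systematic_scan 3 n) t (coloring_of n (z j))"
  have "d_TV (proper_colorings 3 n) (?\<mu> 0) (?\<mu> (2 * n))
      \<le> (\<Sum>j<2 * n. (1 - 1 / (18 * (real n)\<^sup>2)) ^ t * (144 * (real n)\<^sup>2))"
    using d_TV_near[OF assms(1) z(3)] by (intro order_trans[OF d_TV_chain] sum_mono) simp
  also have "\<dots> = 288 * real n ^ 3 * (1 - 1 / (18 * (real n)\<^sup>2)) ^ t"
    by (simp add: power2_eq_square power3_eq_cube)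
  finally show "d_TV (proper_colorings 3 n) (steps (systematic_scan 3 n) t \<sigma>) (steps (systematic_scan 3 n) t \<tau>)
      \<le> 288 * real n ^ 3 * (1 - 1 / (18 * (real n)\<^sup>2)) ^ t"
    by (simp add: z)
qed (use finite_proper_colorings proper_colorings_nonempty systematic_scan_stationary in auto)

text \<open>
  After \<open>90 n\<^sup>2 ln n\<close> sweeps the contraction factor is at most \<open>n\<^sup>-\<^sup>5\<close>, which leaves the bound
  \<open>288 / n\<^sup>2\<close>; it is below \<open>1/4\<close> from \<open>n = 34\<close> on.
\<close>

lemma Mix_scan_le:
  assumes "34 \<le> n"
  shows "Mix_scan 3 n (1/4) \<le> enat (nat \<lceil>90 * (real n)\<^sup>2 * ln (real n)\<rceil>)"
proof -
  define T where "T = nat \<lceil>90 * (real n)\<^sup>2 * ln (real n)\<rceil>"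
  have n: "0 < real n" using assms by simp
  have pos: "0 < 90 * (real n)\<^sup>2 * ln (real n)" using assms by simp
  then have "0 < T" unfolding T_def by simp
  have T: "90 * (real n)\<^sup>2 * ln (real n) \<le> real T"
    unfolding T_def by (rule real_nat_ceiling_ge)
  let ?x = "1 / (18 * (real n)\<^sup>2)"
  have "1 \<le> (real n)\<^sup>2" using assms by (intro one_le_power) simp
  then have "?x \<le> 1" by (simp add: divide_le_eq)
  then have "(1 - ?x) ^ T \<le> exp (- ?x) ^ T"
    using exp_ge_add_one_self[of "- ?x"] by (intro power_mono) auto
  also have "\<dots> = exp (- (real T / (18 * (real n)\<^sup>2)))"
    by (simp add: exp_of_nat_mult[symmetric])
  also have "\<dots> \<le> exp (- (5 * ln (real n)))"
    using T n by (simp add: field_simps)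
  also have "\<dots> = 1 / real n ^ 5"
    using n by (simp add: exp_minus exp_of_nat_mult[of 5, simplified] inverse_eq_divide)
  finally have "288 * real n ^ 3 * (1 - ?x) ^ T \<le> 288 * real n ^ 3 * (1 / real n ^ 5)"
    by (intro mult_left_mono) auto
  also have "\<dots> = 288 / (real n)\<^sup>2" using n by (simp add: field_simps eval_nat_numeral)
  also have "\<dots> \<le> 1 / 4"
  proof -
    have "34\<^sup>2 \<le> (real n)\<^sup>2" using assms by (intro power_mono) auto
    then show ?thesis using n by (simp add: divide_le_eq)
  qed
  finally have small: "288 * real n ^ 3 * (1 - ?x) ^ T \<le> 1 / 4" .
  have "3 \<le> n" using assms by simp
  then have "Mix_scan 3 n (1/4) \<le> enat T"
    unfolding Mix_scan_def
    using small by (intro Mix_le \<open>0 < T\<close> order_trans[OF d_TV_stationary]) auto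
  then show ?thesis by (simp add: T_def)
qed

theorem theorem6:
  shows "(\<forall>\<^sub>F n in sequentially. Mix_scan 3 n (1/4) \<noteq> \<infinity>) \<and>
         (\<lambda>n. real (the_enat (Mix_scan 3 n (1/4)))) \<in> O(\<lambda>n. (real n)\<^sup>2 * ln (real n))"
proof
  show "\<forall>\<^sub>F n in sequentially. Mix_scan 3 n (1/4) \<noteq> \<infinity>"
    using eventually_ge_at_top[of 34]
  proof eventually_elim
    case (elim n)
    then show ?case using Mix_scan_le[of n] by (cases "Mix_scan 3 n (1/4)") auto
  qed
  show "(\<lambda>n. real (the_enat (Mix_scan 3 n (1/4)))) \<in> O(\<lambda>n. (real n)\<^sup>2 * ln (real n))"
  proof (rule bigoI[of _ 91])
    show "\<forall>\<^sub>F n in sequentially. norm (real (the_enat (Mix_scan 3 n (1/4))))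
        \<le> 91 * norm ((real n)\<^sup>2 * ln (real n))"
      using eventually_ge_at_top[of 34]
    proof eventually_elim
      case (elim n)
      have "1 \<le> ln (real n)"
        using elim exp_le by (subst ln_ge_iff) auto
      moreover have "1 \<le> (real n)\<^sup>2" using elim by (intro one_le_power) simp
      ultimately have ge1: "1 \<le> (real n)\<^sup>2 * ln (real n)"
        using mult_mono[of 1 "(real n)\<^sup>2" 1 "ln (real n)"] by simp
      have "the_enat (Mix_scan 3 n (1/4)) \<le> nat \<lceil>90 * (real n)\<^sup>2 * ln (real n)\<rceil>"
        using Mix_scan_le[OF elim] by (cases "Mix_scan 3 n (1/4)") auto
      then have "real (the_enat (Mix_scan 3 n (1/4))) \<le> real (nat \<lceil>90 * (real n)\<^sup>2 * ln (real n)\<rceil>)"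
        by (rule of_nat_mono)
      also have "\<dots> \<le> 90 * (real n)\<^sup>2 * ln (real n) + 1"
        using ge1 by linarith
      also have "\<dots> \<le> 91 * ((real n)\<^sup>2 * ln (real n))" using ge1 by linarith
      finally show ?case using ge1 by simp
    qed
  qed
qed

end
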